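(* Let $\mathsf{a},t,c_1,c_2$ be real numbers such that $\mathsf{a}$, $\mathsf{a}t$, $\mathsf{a}c_1$, $\mathsf{a}c_2t^2$ all lie in the open interval $(0,1)$. For $0\le z<(1-\mathsf{a}t)^2$ let $B=B(z,\mathsf{a}t)<1$ be the smaller root of the equation $$B+\frac1B=\frac{1-z}{\mathsf{a}t}+\mathsf{a}t .$$ Then for every $0\le z<(1-\mathsf{a}t)^2$ small enough that $Bc_1<t$ and $Bc_2t<1$, $$\sum_{N=1}^\infty z^{N-1}G_N(t)=\frac{B}{\mathsf{a}\,(t-c_1B)(1-c_2tB)} .$$
   Context: For $N\ge1$ and $(m_1,\dots,m_N),(n_1,\dots,n_N)\in\mathbb{Z}_{\ge0}^N$ let $\mathbf{L}_1(j)=\sum_{k=1}^j m_k$ and $\mathbf{L}_2(j)=\sum_{k=1}^j n_k$ for $1\le j\le N$, with $\mathbf{L}_1(0)=\mathbf{L}_2(0)=0$. Define the weight $$\mathbb{Q}_N^{(\mathsf{a},c_1,c_2)}(\mathbf{L}_1,\mathbf{L}_2)=\mathsf{a}^{\mathbf{L}_1(N)}\mathsf{a}^{\mathbf{L}_2(N)}(c_1c_2)^{\max_{1\le j\le N}(\mathbf{L}_2(j)-\mathbf{L}_1(j-1))}\,c_2^{\mathbf{L}_1(N)-\mathbf{L}_2(N)}$$ and $$G_N(t)=\sum_{\mathbf{L}_1,\mathbf{L}_2}t^{2\mathbf{L}_1(N)}\,\mathbb{Q}_N^{(\mathsf{a},c_1,c_2)}(\mathbf{L}_1,\mathbf{L}_2),$$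 where the sum is over all pairs of such sequences, i.e. over all $(m_j),(n_j)\in\mathbb{Z}_{\ge0}^N$. *)

theory Defs
  imports "HOL-Analysis.Analysis"
begin

definition psum :: "(nat \<Rightarrow> nat) \<Rightarrow> nat \<Rightarrow> nat" where
  "psum m j = (\<Sum>k=1..j. m k)"

(* The tuples (m_1, ..., m_N) are functions on {1..N}, made unique by being undefined elsewhere. *)
definition increment_seqs :: "nat \<Rightarrow> (nat \<Rightarrow> nat) set" where
  "increment_seqs N = ({1..N} \<rightarrow>\<^sub>E UNIV)"

(* Meaningful for N >= 1 only. *)
definition weight_Q :: "real \<Rightarrow> real \<Rightarrow> real \<Rightarrow> nat \<Rightarrow> (nat \<Rightarrow> nat) \<Rightarrow> (nat \<Rightarrow> nat) \<Rightarrow> real" where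
  "weight_Q a c1 c2 N L1 L2 =
     a ^ L1 N * a ^ L2 N
     * (c1 * c2) powi (MAX j\<in>{1..N}. int (L2 j) - int (L1 (j - 1)))
     * c2 powi (int (L1 N) - int (L2 N))"

definition G_term :: "real \<Rightarrow> real \<Rightarrow> real \<Rightarrow> nat \<Rightarrow> real \<Rightarrow> (nat \<Rightarrow> nat) \<times> (nat \<Rightarrow> nat) \<Rightarrow> real" where
  "G_term a c1 c2 N t = (\<lambda>(m, n).
     t ^ (2 * psum m N) * weight_Q a c1 c2 N (psum m) (psum n))"

(* infsum is 0 by convention on a family that is not summable,
   so statements about G should be accompanied by summability of G_term. *)
definition G :: "real \<Rightarrow> real \<Rightarrow> real \<Rightarrow> nat \<Rightarrow> real \<Rightarrow> real" where
  "G a c1 c2 N t = infsum (G_term a c1 c2 N t) (increment_seqs N \<times> increment_seqs N)"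

definition is_root_B :: "real \<Rightarrow> real \<Rightarrow> real \<Rightarrow> bool" where
  "is_root_B z q b \<longleftrightarrow> b \<noteq> 0 \<and> b + 1 / b = (1 - z) / q + q"

definition smaller_root :: "real \<Rightarrow> real \<Rightarrow> real" where
  "smaller_root z q = (LEAST b. is_root_B z q b)"

lemma smaller_root_wellposed:
  assumes "0 < q" "q < 1" "z < (1 - q)\<^sup>2"
  shows "is_root_B z q (smaller_root z q)"
    and "is_root_B z q b \<longleftrightarrow> b = smaller_root z q \<or> b = 1 / smaller_root z q"
    and "0 < smaller_root z q" "smaller_root z q < 1"
proof -
  define s where "s = (1 - z) / q + q"
  have "2 * q < 1 - z + q * q"
    using assms(3) by (simp add: power2_eq_square algebra_simps)
  then have s2: "2 < s"
    using assms(1) by (simp add: s_def field_simps)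
  define d where "d = sqrt (s\<^sup>2 - 4)"
  have "2\<^sup>2 < s\<^sup>2" using s2 by (intro power_strict_mono) auto
  then have d: "0 < d" "d\<^sup>2 = s\<^sup>2 - 4" by (auto simp: d_def)
  have ds: "d < s" using d s2 by (intro power2_less_imp_less[of d s]) auto
  have "(s - 2)\<^sup>2 < d\<^sup>2" using s2 d by (simp add: power2_eq_square algebra_simps)
  then have sd: "s - 2 < d" using d(1) by (intro power2_less_imp_less[of "s - 2" d]) auto
  define r where "r = (s - d) / 2"
  have r: "0 < r" "r < 1" using ds sd by (auto simp: r_def)
  have "r * (s - r) = 1"
    using d(2) by (simp add: r_def power2_eq_square field_simps)
  then have sr: "s = r + 1 / r" using r by (simp add: field_simps)
  have iff: "is_root_B z q b \<longleftrightarrow> b = r \<or> b = 1 / r" for b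
  proof -
    have "is_root_B z q b \<longleftrightarrow> b \<noteq> 0 \<and> (b - r) * (b - 1 / r) = 0"
      unfolding is_root_B_def s_def[symmetric] sr using r by (auto simp: field_simps)
    then show ?thesis using r by auto
  qed
  have "1 < 1 / r" using r by simp
  then have "r < 1 / r" using r by linarith
  then have "smaller_root z q = r"
    unfolding smaller_root_def by (intro Least_equality) (auto simp: iff)
  then show "is_root_B z q (smaller_root z q)"
    "is_root_B z q b \<longleftrightarrow> b = smaller_root z q \<or> b = 1 / smaller_root z q"
    "0 < smaller_root z q" "smaller_root z q < 1"
    using iff r by auto
qed

end

theory Submission imports Defs begin

text \<open>
  The quantity \<open>K\<^sub>N = max\<^sub>j (L\<^sub>2(j) - L\<^sub>1(j - 1)) + L\<^sub>1(N) - L\<^sub>2(N)\<close> obeys the Lindley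
  recursion \<open>K\<^sub>N\<^sub>+\<^sub>1 = max (K\<^sub>N - n\<^sub>N\<^sub>+\<^sub>1) 0 + m\<^sub>N\<^sub>+\<^sub>1\<close>, and the maximum itself grows by
  \<open>max (n\<^sub>N\<^sub>+\<^sub>1 - K\<^sub>N) 0\<close>. Hence \<open>G\<^sub>N(t) = (T\<^sup>N f)(0)\<close> with \<open>f(k) = c\<^sub>2\<^sup>k\<close> and a positive transfer
  operator \<open>T\<close> depending on \<open>a\<close>, \<open>c = c\<^sub>1\<close> and \<open>s = a t\<^sup>2\<close> only.
  With \<open>r = t B\<close>, the functional \<open>\<phi>(f) = \<Sum>\<^sub>k r\<^sup>k f(k)\<close> satisfies
  \<open>C \<phi>(f) = (T f)(0) + z C \<phi>(T f)\<close> for \<open>C = r / (s - a c r)\<close>; the equation defining \<open>B\<close> is exactly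
  what makes this true. Iterating it yields \<open>\<Sum>\<^sub>N z\<^sup>N (T\<^sup>N\<^sup>+\<^sup>1 f)(0) = C \<phi>(f)\<close>, provided that the remainder
  \<open>z\<^sup>M C \<phi>(T\<^sup>M f)\<close> vanishes, and \<open>\<phi>(f) = 1 / (1 - r c\<^sub>2)\<close>. The remainder decays geometrically because
  some \<open>g \<ge> f\<close> with \<open>\<phi>(g)\<close> finite satisfies \<open>z T g \<le> \<theta> g\<close> with \<open>\<theta> < 1\<close>.
\<close>

section \<open>The transfer operator and its action on powers\<close>

definition tail_sum :: "real \<Rightarrow> (nat \<Rightarrow> ennreal) \<Rightarrow> nat \<Rightarrow> ennreal" where
  "tail_sum s f j = (\<Sum>p. ennreal (s ^ p) * f (j + p))"

text \<open>\<open>q\<close> is the next value of \<open>n\<close>; \<open>p\<close>, summed inside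
  \<open>tail_sum\<close>, is the next value of \<open>m\<close>. Truncated subtraction supplies
  both positive parts, and values in \<open>ennreal\<close> make the sums meaningful without
  convergence conditions.\<close>

definition step :: "real \<Rightarrow> real \<Rightarrow> real \<Rightarrow> (nat \<Rightarrow> ennreal) \<Rightarrow> nat \<Rightarrow> ennreal" where
  "step a c s f k = (\<Sum>q. ennreal (a ^ q * c ^ (q - k)) * tail_sum s f (k - q))"

lemma suminf_ennreal_head: "(\<Sum>n. f n) = f 0 + (\<Sum>n. f (Suc n))" for f :: "nat \<Rightarrow> ennreal"
  using suminf_offset[of f 1] by (simp add: summableI)

lemma tail_sum_rec:
  assumes "0 \<le> s"
  shows "tail_sum s f j = f j + ennreal s * tail_sum s f (Suc j)"
  unfolding tail_sum_def
  by (subst suminf_ennreal_head)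
     (simp add: assms ennreal_mult mult.assoc)

text \<open>After splitting off \<open>q = 0\<close>, the successors in \<open>Suc q - Suc k\<close>
  and \<open>Suc k - Suc q\<close> cancel, so the shifted sum is \<open>step\<close> at
  \<open>k\<close> again.\<close>

lemma step_Suc:
  assumes "0 \<le> a" "0 \<le> c"
  shows "step a c s f (Suc k) = tail_sum s f (Suc k) + ennreal a * step a c s f k"
  unfolding step_def
  by (subst suminf_ennreal_head)
     (simp add: assms ennreal_mult mult.assoc)

lemma suminf_geometric_ennreal:
  assumes "0 \<le> x" "x < 1"
  shows "(\<Sum>n. ennreal (x ^ n)) = ennreal (1 / (1 - x))"
  using geometric_sums[of x] assms by (intro suminf_ennreal_eq) auto

lemma step_0:
  assumes "0 \<le> a" "0 \<le> c" "a * c < 1"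
  shows "step a c s f 0 = ennreal (1 / (1 - a * c)) * tail_sum s f 0"
proof -
  have "step a c s f 0 = (\<Sum>q. tail_sum s f 0 * ennreal ((a * c) ^ q))"
    unfolding step_def by (simp add: power_mult_distrib mult.commute)
  also have "\<dots> = tail_sum s f 0 * ennreal (1 / (1 - a * c))"
    using assms by (subst ennreal_suminf_cmult, subst suminf_geometric_ennreal) simp_all
  finally show ?thesis by (simp add: mult.commute)
qed

lemma step_mono: "(\<And>k. f k \<le> g k) \<Longrightarrow> step a c s f k \<le> step a c s g k"
  unfolding step_def tail_sum_def
  by (intro suminf_le mult_left_mono summableI) auto

lemma step_add: "step a c s (\<lambda>k. f k + g k) k = step a c s f k + step a c s g k"
  unfolding step_def tail_sum_def
  by (simp add: distrib_left suminf_add[symmetric] summableI)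

lemma step_cmult: "step a c s (\<lambda>k. b * f k) k = b * step a c s f k"
  unfolding step_def tail_sum_def
  by (simp add: mult.left_commute[of _ b])

lemma tail_sum_power:
  assumes "0 \<le> s" "0 \<le> x" "s * x < 1"
  shows "tail_sum s (\<lambda>k. ennreal (x ^ k)) j = ennreal (x ^ j / (1 - s * x))"
proof -
  have "tail_sum s (\<lambda>k. ennreal (x ^ k)) j = (\<Sum>p. ennreal (x ^ j) * ennreal ((s * x) ^ p))"
    unfolding tail_sum_def using assms
    by (simp add: power_add power_mult_distrib ennreal_mult[symmetric] mult_ac)
  also have "\<dots> = ennreal (x ^ j) * ennreal (1 / (1 - s * x))"
    using assms by (subst ennreal_suminf_cmult, subst suminf_geometric_ennreal) simp_all
  finally show ?thesis
    using assms by (simp add: ennreal_mult[symmetric])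
qed

text \<open>On a power, \<open>step_Suc\<close> is a first-order linear recursion in
  \<open>k\<close>: the term in \<open>x ^ k\<close> is a particular solution and
  \<open>a ^ k\<close> solves the homogeneous recursion. The condition on \<open>b\<close> is the
  case \<open>k = 0\<close>.\<close>

lemma step_power_le:
  assumes "0 \<le> a" "0 \<le> c" "a * c < 1" "0 \<le> s" "a < x" "s * x < 1" "0 \<le> b"
    and b: "1 / ((1 - s * x) * (1 - a * c)) \<le> x / ((1 - s * x) * (x - a)) + b"
  shows "step a c s (\<lambda>k. ennreal (x ^ k)) k
    \<le> ennreal (x / ((1 - s * x) * (x - a)) * x ^ k + b * a ^ k)"
proof (induction k)
  case 0
  have "step a c s (\<lambda>k. ennreal (x ^ k)) 0 = ennreal (1 / ((1 - s * x) * (1 - a * c)))"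
    using assms by (simp add: step_0 tail_sum_power ennreal_mult[symmetric] mult.commute)
  then show ?case
    using b by (auto intro!: ennreal_leI simp del: ennreal_plus)
next
  case (Suc k)
  define l where "l = x / ((1 - s * x) * (x - a))"
  have l: "0 \<le> l" "x / (1 - s * x) + a * l = l * x"
    using assms by (auto simp: l_def divide_simps) (auto simp: algebra_simps)
  have "step a c s (\<lambda>k. ennreal (x ^ k)) (Suc k)
      \<le> ennreal (x ^ Suc k / (1 - s * x)) + ennreal a * ennreal (l * x ^ k + b * a ^ k)"
    using Suc assms by (simp add: step_Suc tail_sum_power l_def mult_left_mono)
  also have "\<dots> = ennreal (x ^ Suc k / (1 - s * x) + a * (l * x ^ k + b * a ^ k))"
    using assms l by (simp add: ennreal_mult[symmetric] ennreal_plus[symmetric] del: ennreal_plus)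
  also have "x ^ Suc k / (1 - s * x) + a * (l * x ^ k + b * a ^ k)
      = (x / (1 - s * x) + a * l) * x ^ k + b * a ^ Suc k"
    by (simp add: algebra_simps)
  also have "\<dots> = l * x ^ Suc k + b * a ^ Suc k"
    unfolding l(2) by simp
  finally show ?case unfolding l_def .
qed

section \<open>The functional \<open>pairing\<close> and its identity under one step\<close>

definition pairing :: "real \<Rightarrow> (nat \<Rightarrow> ennreal) \<Rightarrow> ennreal" where
  "pairing r f = (\<Sum>k. ennreal (r ^ k) * f k)"

lemma pairing_mono: "(\<And>k. f k \<le> g k) \<Longrightarrow> pairing r f \<le> pairing r g"
  unfolding pairing_def by (intro suminf_le mult_left_mono summableI) auto

lemma pairing_add: "pairing r (\<lambda>k. f k + g k) = pairing r f + pairing r g"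
  unfolding pairing_def by (simp add: distrib_left suminf_add[symmetric] summableI)

lemma pairing_cmult: "pairing r (\<lambda>k. b * f k) = b * pairing r f"
  unfolding pairing_def by (simp add: mult.left_commute[of _ b])

lemma pairing_head:
  "0 \<le> r \<Longrightarrow> pairing r f = f 0 + ennreal r * pairing r (\<lambda>k. f (Suc k))"
  unfolding pairing_def
  by (subst suminf_ennreal_head) (simp add: ennreal_mult mult.assoc)

lemma pairing_power:
  assumes "0 \<le> r" "0 \<le> x" "r * x < 1"
  shows "pairing r (\<lambda>k. ennreal (x ^ k)) = ennreal (1 / (1 - r * x))"
  unfolding pairing_def using suminf_geometric_ennreal[of "r * x"] assms
  by (simp add: power_mult_distrib ennreal_mult)

text \<open>Pairing the recursions for \<open>step\<close> and \<open>tail_sum\<close> gives linear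
  relations among pairings and values at 0; the condition on \<open>z\<close> lets
  \<open>tail_sum\<close> be eliminated.\<close>

lemma pairing_step:
  assumes "0 < a" "0 \<le> c" "a * c < 1" "0 \<le> s" "0 < r" "a * c * r < s" "0 \<le> z"
    and z: "(1 - a * r) * (r - s) = z * r"
    and fin: "pairing r (step a c s f) < top"
  shows "ennreal (r / (s - a * c * r)) * pairing r f
    = step a c s f 0 + ennreal (z * (r / (s - a * c * r))) * pairing r (step a c s f)"
proof -
  let ?u = "step a c s f" and ?g = "tail_sum s f"
  \<comment> \<open>Since \<open>f \<le> ?g \<le> ?u\<close> pointwise, finiteness passes down to
    every quantity involved, and the elimination can subtract in the reals.\<close>
  have gu: "?g k \<le> ?u k" for k
  proof (cases k)
    case 0
    have "1 * ?g 0 \<le> ennreal (1 / (1 - a * c)) * ?g 0"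
      using assms by (intro mult_right_mono) (auto simp: ennreal_1[symmetric] simp del: ennreal_1 intro!: ennreal_leI)
    then show ?thesis using 0 assms by (simp add: step_0)
  qed (use assms in \<open>simp add: step_Suc\<close>)
  have fg: "f k \<le> ?g k" for k
    using assms by (subst tail_sum_rec) auto
  have finG: "pairing r ?g < top"
    using pairing_mono[of ?g ?u r] gu fin by (auto intro: order.strict_trans1)
  have finF: "pairing r f < top"
    using pairing_mono[of f ?g r] fg finG by (auto intro: order.strict_trans1)
  have fin0: "?u 0 < top" "?g 0 < top"
    using fin finG pairing_head[of r ?u] pairing_head[of r ?g] assms
    by (auto simp: less_top)
  define U where "U = enn2real (pairing r ?u)"
  define H where "H = enn2real (pairing r ?g)"
  define F where "F = enn2real (pairing r f)"
  define u where "u = enn2real (?u 0)"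
  define g where "g = enn2real (?g 0)"
  have [simp]: "U \<ge> 0" "H \<ge> 0" "F \<ge> 0" "u \<ge> 0" "g \<ge> 0"
    by (auto simp: U_def H_def F_def u_def g_def)
  have conv: "pairing r ?u = ennreal U" "pairing r ?g = ennreal H" "pairing r f = ennreal F"
    "?u 0 = ennreal u" "?g 0 = ennreal g"
    using fin finG finF fin0 by (simp_all add: U_def H_def F_def u_def g_def less_top)
  have e1: "u * (1 - a * c) = g"
  proof -
    have "ennreal u = ennreal (g / (1 - a * c))"
      using step_0[of a c s f] assms by (simp add: conv ennreal_mult[symmetric])
    then show ?thesis using assms by (simp add: field_simps)
  qed
  have "pairing r ?u = ?u 0 + ennreal r * (pairing r (\<lambda>k. ?g (Suc k)) + ennreal a * pairing r ?u)"
    using assms by (subst pairing_head) (simp_all add: step_Suc pairing_add pairing_cmult)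
  \<comment> \<open>Adding the value at 0 completes the shifted pairing of \<open>?g\<close> without
    subtracting in \<open>ennreal\<close>; \<open>e3\<close> uses the same device.\<close>
  then have "pairing r ?u + ?g 0 = ?u 0 + pairing r ?g + ennreal (a * r) * pairing r ?u"
    using assms pairing_head[of r ?g] by (simp add: ennreal_mult distrib_left mult_ac add_ac)
  then have e2: "U + g = u + H + a * r * U"
    using assms by (simp add: conv ennreal_mult[symmetric] ennreal_plus[symmetric] del: ennreal_plus)
  have "?g = (\<lambda>k. f k + ennreal s * ?g (Suc k))"
    using assms by (intro ext tail_sum_rec)
  then have "pairing r ?g = pairing r f + ennreal s * pairing r (\<lambda>k. ?g (Suc k))"
    using pairing_add[of r f "\<lambda>k. ennreal s * ?g (Suc k)"] by (simp add: pairing_cmult)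
  then have "ennreal r * pairing r ?g + ennreal s * ?g 0 = ennreal r * pairing r f
      + ennreal s * (?g 0 + ennreal r * pairing r (\<lambda>k. ?g (Suc k)))"
    by (simp add: distrib_left mult_ac add_ac)
  then have "ennreal r * pairing r ?g + ennreal s * ?g 0 = ennreal r * pairing r f + ennreal s * pairing r ?g"
    using assms pairing_head[of r ?g] by simp
  then have e3: "r * H + s * g = r * F + s * H"
    using assms by (simp add: conv ennreal_mult[symmetric] ennreal_plus[symmetric] del: ennreal_plus)
  have "z * r * U = (r - s) * ((1 - a * r) * U)"
    using z by (metis mult.commute mult.assoc)
  also have "(1 - a * r) * U = u + H - g"
    using e2 by (simp add: algebra_simps)
  also have "(r - s) * (u + H - g) = r * F - (s - a * c * r) * u"
    using e3 unfolding e1[symmetric] by (simp add: algebra_simps)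
  finally have "r / (s - a * c * r) * F = u + z * (r / (s - a * c * r)) * U"
    using assms by (simp add: field_simps)
  then show ?thesis
    using assms by (simp add: conv ennreal_mult[symmetric] ennreal_plus[symmetric] del: ennreal_plus)
qed


section \<open>Growth, iteration and contraction\<close>

text \<open>A crude bound that serves only finiteness: \<open>L\<close> may be large. As
  \<open>a < x\<close>, the term in \<open>a ^ k\<close> is absorbed into
  \<open>x ^ k\<close>.\<close>

lemma funpow_step_power_le:
  assumes "0 \<le> a" "0 \<le> c" "a * c < 1" "0 \<le> s" "a < x" "s * x < 1"
  obtains L where "0 \<le> L"
    "\<And>N k. (step a c s ^^ N) (\<lambda>k. ennreal (x ^ k)) k \<le> ennreal (L ^ N * x ^ k)"
proof -
  define b where "b = 1 / ((1 - s * x) * (1 - a * c))"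
  define l where "l = x / ((1 - s * x) * (x - a))"
  have nn: "0 \<le> b" "0 \<le> l" using assms by (auto simp: b_def l_def)
  have *: "step a c s (\<lambda>k. ennreal (x ^ k)) k \<le> ennreal ((l + b) * x ^ k)" for k
  proof -
    have "b * a ^ k \<le> b * x ^ k"
      using assms nn by (intro mult_left_mono power_mono) auto
    then show ?thesis
      using step_power_le[of a c s x b k] assms nn
      by (auto simp: b_def l_def distrib_right intro: order_trans ennreal_leI simp del: ennreal_plus)
  qed
  have "(step a c s ^^ N) (\<lambda>k. ennreal (x ^ k)) k \<le> ennreal ((l + b) ^ N * x ^ k)" for N k
  proof (induction N arbitrary: k)
    case (Suc N)
    have "(step a c s ^^ Suc N) (\<lambda>k. ennreal (x ^ k)) k
        \<le> step a c s (\<lambda>k. ennreal ((l + b) ^ N) * ennreal (x ^ k)) k"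
      using Suc nn assms by (auto intro!: step_mono simp: ennreal_mult simp del: ennreal_plus)
    also have "\<dots> \<le> ennreal ((l + b) ^ N) * ennreal ((l + b) * x ^ k)"
      by (subst step_cmult) (intro mult_left_mono *; simp)
    also have "\<dots> = ennreal ((l + b) ^ Suc N * x ^ k)"
      using nn assms by (simp add: ennreal_mult[symmetric] mult_ac del: ennreal_plus)
    finally show ?case .
  qed simp
  with that[of "l + b"] nn show thesis by simp
qed

text \<open>\<open>pairing_step\<close> applied to successive iterates telescopes; the remainder
  stays explicit and no limit is taken yet.\<close>

lemma pairing_iterate:
  assumes "0 < a" "0 \<le> c" "a * c < 1" "0 \<le> s" "0 < r" "a * c * r < s" "0 \<le> z"
    and "(1 - a * r) * (r - s) = z * r"
    and "\<And>N. pairing r ((step a c s ^^ N) f) < top"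
  shows "ennreal (r / (s - a * c * r)) * pairing r f
    = (\<Sum>N<M. ennreal (z ^ N) * (step a c s ^^ Suc N) f 0)
      + ennreal (z ^ M * (r / (s - a * c * r))) * pairing r ((step a c s ^^ M) f)"
proof (induction M)
  case (Suc M)
  define C where "C = r / (s - a * c * r)"
  let ?T = "step a c s"
  have C: "0 \<le> C" using assms by (simp add: C_def)
  have "ennreal C * pairing r ((?T ^^ M) f)
      = (?T ^^ Suc M) f 0 + ennreal (z * C) * pairing r ((?T ^^ Suc M) f)"
    unfolding C_def using pairing_step[of a c s r z "(?T ^^ M) f"] assms assms(9)[of "Suc M"] by simp
  then have "ennreal (z ^ M) * (ennreal C * pairing r ((?T ^^ M) f))
      = ennreal (z ^ M) * ((?T ^^ Suc M) f 0 + ennreal (z * C) * pairing r ((?T ^^ Suc M) f))"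
    by simp
  then show ?case
    using Suc assms C unfolding C_def[symmetric]
    by (simp add: ennreal_mult distrib_left mult.assoc mult.left_commute add.assoc)
qed simp

text \<open>
  A single power \<open>x\<^sup>k\<close> need not be contracted, since \<open>c x\<close> may exceed \<open>1\<close>: then \<open>T\<close> maps it to
  \<open>\<lambda> x\<^sup>k + \<beta> a\<^sup>k\<close> with \<open>\<beta> > 0\<close>. The extra term is absorbed by \<open>K y\<^sup>k\<close>, where \<open>y\<close> lies
  strictly above the smaller root \<open>a r / s\<close> of the kernel \<open>(1 - s w) (w - a) = z w\<close>, whose larger root is
  \<open>1 / r\<close>, and \<open>c y < 1\<close>.
\<close>
lemma step_contraction:
  assumes "0 < a" "0 < c" "a * c < 1" "0 < s" "s \<le> r" "a * r < 1" "a * c * r < s" "a * r\<^sup>2 < s"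
    and "0 \<le> z" and z: "(1 - a * r) * (r - s) = z * r"
    and "0 < x" "r * x < 1"
  obtains X K y \<theta> where "x \<le> X" "a < X" "r * X < 1" "0 \<le> K" "0 \<le> y" "r * y < 1" "0 \<le> \<theta>" "\<theta> < 1"
    "\<And>k. ennreal z * step a c s (\<lambda>k. ennreal (X ^ k + K * y ^ k)) k
      \<le> ennreal (\<theta> * (X ^ k + K * y ^ k))"
proof -
  have r: "0 < r" using assms by linarith
  \<comment> \<open>The interval for \<open>y\<close> is nonempty: \<open>a * r\<^sup>2 < s\<close>
    gives the bound \<open>1 / r\<close>, and \<open>a * c * r < s\<close> gives
    \<open>1 / c\<close>.\<close>
  have "a * r / s < min (1 / r) (1 / c)"
    using assms r by (auto simp: field_simps power2_eq_square)
  then obtain y where y: "a * r / s < y" "y < min (1 / r) (1 / c)"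
    using dense by blast
  define X where "X = max x y"
  define l where "l w = w / ((1 - s * w) * (w - a))" for w
  have ay: "a \<le> a * r / s" using assms by (simp add: field_simps)
  have l: "a < w" "s * w < 1" "0 \<le> l w" "z * l w < 1" if w: "a * r / s < w" "r * w < 1" for w
  proof -
    show aw: "a < w" using w ay by linarith
    have "s * w \<le> r * w" using assms aw by (intro mult_right_mono) auto
    then show sw: "s * w < 1" using w by linarith
    then show "0 \<le> l w" using assms aw by (simp add: l_def)
    \<comment> \<open>Up to the factor \<open>r\<close>, this product is the kernel difference
      \<open>(1 - s * w) * (w - a) - z * w\<close>, positive strictly between its roots.\<close>
    have "0 < (s * w - a * r) * (1 - r * w)"
      using w assms by (intro mult_pos_pos) (auto simp: field_simps)
    also have "\<dots> = r * ((1 - s * w) * (w - a)) - ((1 - a * r) * (r - s)) * w"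
      by (simp add: algebra_simps)
    also have "\<dots> = r * ((1 - s * w) * (w - a) - z * w)"
      unfolding z by (simp add: algebra_simps)
    finally have "z * w < (1 - s * w) * (w - a)"
      using r by (simp add: zero_less_mult_iff)
    then show "z * l w < 1"
      using aw sw by (simp add: l_def)
  qed
  have ry: "r * y < 1" "c * y < 1" using y r assms by (auto simp: field_simps)
  have rX: "r * X < 1" using ry assms by (auto simp: X_def max_def)
  have aX: "a * r / s < X" using y by (simp add: X_def)
  note ly = l[OF y(1) ry(1)] and lX = l[OF aX rX]
  define b where "b = 1 / ((1 - s * X) * (1 - a * c))"
  have b: "0 \<le> b" using lX assms by (simp add: b_def)
  \<comment> \<open>The midpoint of \<open>z * l y\<close> and 1 leaves a strict gap above
    \<open>z * l y\<close>, by which \<open>K\<close> divides.\<close>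
  define \<theta> where "\<theta> = max (z * l X) ((1 + z * l y) / 2)"
  have \<theta>: "z * l X \<le> \<theta>" "z * l y < \<theta>" "\<theta> < 1" "0 \<le> \<theta>"
    using ly lX \<open>0 \<le> z\<close> by (auto simp: \<theta>_def le_max_iff_disj less_max_iff_disj)
  \<comment> \<open>The leftover \<open>z * b * a ^ k\<close> is at most
    \<open>z * b * y ^ k\<close>; \<open>K\<close> is the coefficient for which this fits exactly
    into \<open>\<theta> * K * y ^ k\<close>.\<close>
  define K where "K = z * b / (\<theta> - z * l y)"
  have K: "0 \<le> K" "z * b + K * (z * l y) = \<theta> * K"
    using \<theta> b \<open>0 \<le> z\<close> by (auto simp: K_def field_simps)
  have TX: "step a c s (\<lambda>k. ennreal (X ^ k)) k \<le> ennreal (l X * X ^ k + b * a ^ k)" for k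
    using step_power_le[of a c s X b k] assms lX b by (simp add: l_def b_def del: ennreal_plus)
  \<comment> \<open>As \<open>c * y < 1\<close>, the value at \<open>k = 0\<close> is already at
    most \<open>l y\<close>, so \<open>step_power_le\<close> applies with
    \<open>b = 0\<close>.\<close>
  have "1 / ((1 - s * y) * (1 - a * c)) \<le> l y + 0"
  proof -
    have "y - a \<le> y * (1 - a * c)"
      using ry assms mult_left_mono[of "c * y" 1 a] by (simp add: algebra_simps)
    then have "1 / (1 - a * c) \<le> y / (y - a)"
      using assms ly by (simp add: field_simps)
    then have "1 / (1 - s * y) * (1 / (1 - a * c)) \<le> 1 / (1 - s * y) * (y / (y - a))"
      using ly by (intro mult_left_mono) auto
    then show ?thesis by (simp add: l_def)
  qed
  then have Ty: "step a c s (\<lambda>k. ennreal (y ^ k)) k \<le> ennreal (l y * y ^ k)" for k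
    using step_power_le[of a c s y 0 k] assms ly by (simp add: l_def)
  have main: "ennreal z * step a c s (\<lambda>k. ennreal (X ^ k + K * y ^ k)) k
      \<le> ennreal (\<theta> * (X ^ k + K * y ^ k))" for k
  proof -
    have pos: "0 \<le> X" "0 \<le> y" using ly lX assms by auto
    have "step a c s (\<lambda>k. ennreal (X ^ k + K * y ^ k)) k
        = step a c s (\<lambda>k. ennreal (X ^ k)) k + ennreal K * step a c s (\<lambda>k. ennreal (y ^ k)) k"
      using pos K by (simp add: ennreal_mult step_add step_cmult)
    also have "\<dots> \<le> ennreal (l X * X ^ k + b * a ^ k) + ennreal K * ennreal (l y * y ^ k)"
      by (intro add_mono mult_left_mono TX Ty) auto
    also have "\<dots> = ennreal (l X * X ^ k + b * a ^ k + K * (l y * y ^ k))"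
      using pos K b ly lX assms
      by (simp add: ennreal_mult[symmetric] ennreal_plus[symmetric] del: ennreal_plus)
    finally have "ennreal z * step a c s (\<lambda>k. ennreal (X ^ k + K * y ^ k)) k
        \<le> ennreal z * ennreal (l X * X ^ k + b * a ^ k + K * (l y * y ^ k))"
      by (intro mult_left_mono) auto
    also have "\<dots> = ennreal (z * (l X * X ^ k + b * a ^ k + K * (l y * y ^ k)))"
      using pos K b ly lX assms by (simp add: ennreal_mult[symmetric] del: ennreal_plus)
    also have "z * (l X * X ^ k + b * a ^ k + K * (l y * y ^ k))
        \<le> \<theta> * X ^ k + (z * b + K * (z * l y)) * y ^ k"
    proof -
      have "z * l X * X ^ k \<le> \<theta> * X ^ k"
        using pos \<theta> by (intro mult_right_mono) auto
      moreover have "z * b * a ^ k \<le> z * b * y ^ k"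
        using assms b ly by (intro mult_left_mono power_mono) auto
      ultimately show ?thesis by (simp add: algebra_simps)
    qed
    also have "\<dots> = \<theta> * (X ^ k + K * y ^ k)"
      unfolding K by (simp add: algebra_simps)
    finally show ?thesis by (simp add: ennreal_leI del: ennreal_plus)
  qed
  show thesis
    by (rule that[of X K y \<theta>]) (use lX ly rX ry K \<theta> assms main in \<open>auto simp: X_def\<close>)
qed

section \<open>Summing the iterates at 0\<close>

lemma step_sums:
  assumes "0 < a" "0 < c" "a * c < 1" "0 < s" "s \<le> r" "a * r < 1" "a * c * r < s" "a * r\<^sup>2 < s"
    and "0 \<le> z" "(1 - a * r) * (r - s) = z * r"
    and "0 < x" "r * x < 1"
  shows "(\<lambda>N. z ^ N * enn2real ((step a c s ^^ Suc N) (\<lambda>k. ennreal (x ^ k)) 0))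
    sums (r / ((s - a * c * r) * (1 - r * x)))"
proof -
  let ?T = "step a c s" and ?f = "\<lambda>k. ennreal (x ^ k)"
  have r: "0 < r" using assms by linarith
  obtain X K y \<theta> where *: "x \<le> X" "a < X" "r * X < 1" "0 \<le> K" "0 \<le> y" "r * y < 1" "0 \<le> \<theta>" "\<theta> < 1"
    and contr: "\<And>k. ennreal z * ?T (\<lambda>k. ennreal (X ^ k + K * y ^ k)) k
      \<le> ennreal (\<theta> * (X ^ k + K * y ^ k))"
    using step_contraction[OF assms] by blast
  have X: "0 \<le> X" using * assms by linarith
  have "s * X \<le> r * X" using assms X by (intro mult_right_mono) auto
  then have "s * X < 1" using * by linarith
  then obtain L where L: "0 \<le> L"
    "\<And>N k. (?T ^^ N) (\<lambda>k. ennreal (X ^ k)) k \<le> ennreal (L ^ N * X ^ k)"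
    using funpow_step_power_le[of a c s X] assms * by auto
  have fX: "(?T ^^ N) ?f k \<le> (?T ^^ N) (\<lambda>k. ennreal (X ^ k)) k" for N k
  proof (induction N arbitrary: k)
    case 0
    then show ?case using * assms by (auto intro!: ennreal_leI power_mono)
  qed (auto intro: step_mono)
  have fL: "(?T ^^ N) ?f k \<le> ennreal (L ^ N) * ennreal (X ^ k)" for N k
    using order_trans[OF fX L(2)] L X by (simp add: ennreal_mult)
  have fin: "pairing r ((?T ^^ N) ?f) < top" for N
  proof -
    have "pairing r ((?T ^^ N) ?f) \<le> ennreal (L ^ N) * ennreal (1 / (1 - r * X))"
      using pairing_mono[of "(?T ^^ N) ?f" "\<lambda>k. ennreal (L ^ N) * ennreal (X ^ k)" r] fL r X *
      by (simp add: pairing_cmult pairing_power)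
    also have "\<dots> < top" by (simp add: ennreal_mult_less_top)
    finally show ?thesis .
  qed
  \<comment> \<open>\<open>enn2real\<close> sends infinity to 0, so passing to real terms is
    faithful only because these values are finite.\<close>
  have fin0: "(?T ^^ N) ?f 0 < top" for N
    by (rule order.strict_trans1[OF fL]) (simp add: ennreal_mult_less_top)
  define g where "g k = ennreal (X ^ k + K * y ^ k)" for k
  have decay: "ennreal (z ^ M) * (?T ^^ M) ?f k \<le> ennreal (\<theta> ^ M) * g k" for M k
  proof (induction M arbitrary: k)
    case 0
    have "x ^ k \<le> X ^ k + K * y ^ k"
      using * assms by (intro add_increasing2 power_mono) auto
    then show ?case by (auto simp: g_def intro: ennreal_leI simp del: ennreal_plus)
  next
    case (Suc M)
    have "ennreal (z ^ Suc M) * (?T ^^ Suc M) ?f k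
        = ennreal z * ?T (\<lambda>k. ennreal (z ^ M) * (?T ^^ M) ?f k) k"
      using assms by (simp add: step_cmult ennreal_mult mult.assoc)
    also have "\<dots> \<le> ennreal z * ?T (\<lambda>k. ennreal (\<theta> ^ M) * g k) k"
      by (intro mult_left_mono step_mono Suc) auto
    also have "\<dots> = ennreal (\<theta> ^ M) * (ennreal z * ?T g k)"
      by (simp add: step_cmult mult.left_commute)
    also have "\<dots> \<le> ennreal (\<theta> ^ M) * ennreal (\<theta> * (X ^ k + K * y ^ k))"
      using contr[of k] by (intro mult_left_mono) (auto simp: g_def[abs_def])
    also have "\<dots> = ennreal (\<theta> ^ Suc M) * g k"
      using * X by (simp add: g_def ennreal_mult[symmetric] mult_ac del: ennreal_plus)
    finally show ?case .
  qed
  define C where "C = r / (s - a * c * r)"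
  define V where "V = r / ((s - a * c * r) * (1 - r * x))"
  define P where "P = 1 / (1 - r * X) + K * (1 / (1 - r * y))"
  have C: "0 \<le> C" using r assms by (simp add: C_def)
  have P: "0 \<le> P" using * by (simp add: P_def)
  have pg: "pairing r g = ennreal P"
  proof -
    have "g = (\<lambda>k. ennreal (X ^ k) + ennreal K * ennreal (y ^ k))"
      using * X by (auto simp: g_def ennreal_mult)
    moreover have "ennreal P = ennreal (1 / (1 - r * X)) + ennreal K * ennreal (1 / (1 - r * y))"
      unfolding P_def using * by (subst ennreal_plus) (simp_all add: ennreal_mult[symmetric])
    ultimately show ?thesis
      using * X r by (simp add: pairing_add pairing_cmult pairing_power)
  qed
  have rem: "ennreal (z ^ M * C) * pairing r ((?T ^^ M) ?f) \<le> ennreal (C * P * \<theta> ^ M)" for M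
  proof -
    have "ennreal (z ^ M * C) * pairing r ((?T ^^ M) ?f)
        = ennreal C * pairing r (\<lambda>k. ennreal (z ^ M) * (?T ^^ M) ?f k)"
      using C assms by (simp add: pairing_cmult ennreal_mult mult_ac)
    also have "\<dots> \<le> ennreal C * pairing r (\<lambda>k. ennreal (\<theta> ^ M) * g k)"
      by (intro mult_left_mono pairing_mono decay) auto
    also have "\<dots> = ennreal (C * P * \<theta> ^ M)"
      unfolding pairing_cmult pg using C P * by (simp add: ennreal_mult mult_ac)
    finally show ?thesis .
  qed
  let ?S = "\<lambda>M. \<Sum>N<M. z ^ N * enn2real ((?T ^^ Suc N) ?f 0)"
  \<comment> \<open>The partial sum misses \<open>V\<close> by exactly the remainder
    \<open>R\<close> of \<open>pairing_iterate\<close>, which is geometrically small by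
    \<open>rem\<close>.\<close>
  have bound: "norm (V - ?S M) \<le> C * P * \<theta> ^ M" for M
  proof -
    obtain R where R: "ennreal (z ^ M * C) * pairing r ((?T ^^ M) ?f) = ennreal R" "0 \<le> R"
      using rem[of M] by (metis ennreal_cases ennreal_neq_top neq_top_trans)
    have "ennreal V = ennreal C * pairing r ?f"
      using assms r by (simp add: pairing_power C_def V_def ennreal_mult[symmetric])
    also have "\<dots> = (\<Sum>N<M. ennreal (z ^ N) * (?T ^^ Suc N) ?f 0) + ennreal R"
      using pairing_iterate[of a c s r z ?f M] assms r fin by (simp add: C_def[symmetric] R)
    also have "(\<Sum>N<M. ennreal (z ^ N) * (?T ^^ Suc N) ?f 0) = ennreal (?S M)"
    proof -
      have "ennreal (z ^ N) * (?T ^^ Suc N) ?f 0 = ennreal (z ^ N * enn2real ((?T ^^ Suc N) ?f 0))" for N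
        using fin0[of "Suc N"] assms by (subst ennreal_mult) (auto simp del: funpow.simps)
      then show ?thesis
        using assms by (simp add: sum_ennreal del: funpow.simps)
    qed
    finally have "ennreal V = ennreal (?S M + R)"
      using R assms by (subst ennreal_plus) (auto intro!: sum_nonneg)
    moreover have "0 \<le> V" "0 \<le> ?S M" using r assms by (auto simp: V_def intro!: sum_nonneg)
    ultimately have "V = ?S M + R"
      using R by (simp del: ennreal_plus)
    moreover have "R \<le> C * P * \<theta> ^ M"
      using rem[of M] C P * unfolding R(1) by simp
    ultimately show ?thesis using R by simp
  qed
  have "(\<lambda>M. C * P * \<theta> ^ M) \<longlonglongrightarrow> C * P * 0"
    using * by (intro tendsto_mult tendsto_const LIMSEQ_power_zero) auto
  then have "(\<lambda>M. C * P * \<theta> ^ M) \<longlonglongrightarrow> 0" by simp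
  then have "(\<lambda>M. V - ?S M) \<longlonglongrightarrow> 0"
    by (rule Lim_null_comparison[rotated]) (use bound in auto)
  then have "?S \<longlonglongrightarrow> V"
    using tendsto_diff[OF tendsto_const[of V]] by fastforce
  then show ?thesis unfolding sums_def V_def .
qed

section \<open>The Lindley recursion behind the weight\<close>

primrec queue :: "(nat \<Rightarrow> nat) \<Rightarrow> (nat \<Rightarrow> nat) \<Rightarrow> nat \<Rightarrow> nat" where
  "queue m n 0 = 0"
| "queue m n (Suc N) = (queue m n N - n (Suc N)) + m (Suc N)"

primrec overflow :: "(nat \<Rightarrow> nat) \<Rightarrow> (nat \<Rightarrow> nat) \<Rightarrow> nat \<Rightarrow> nat" where
  "overflow m n 0 = 0"
| "overflow m n (Suc N) = overflow m n N + (n (Suc N) - queue m n N)"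

lemma psum_0 [simp]: "psum m 0 = 0"
  and psum_Suc [simp]: "psum m (Suc N) = psum m N + m (Suc N)"
  by (simp_all add: psum_def)

text \<open>Conservation: each unit of \<open>n\<close> either removes a unit from the queue or is
  counted in \<open>overflow\<close>.\<close>

lemma queue_eq: "int (queue m n N) = int (overflow m n N) + int (psum m N) - int (psum n N)"
  by (induction N) auto

text \<open>By \<open>queue_eq\<close> each new candidate is the old \<open>overflow\<close> plus
  the new \<open>n\<close> minus \<open>queue\<close>, so taking the maximum adds the positive part
  of that difference. The index \<open>Suc N\<close> keeps the range nonempty.\<close>

lemma overflow_eq_Max:
  "(MAX j\<in>{1..Suc N}. int (psum n j) - int (psum m (j - 1))) = int (overflow m n (Suc N))"
proof (induction N)
  case (Suc N)
  have "{1..Suc (Suc N)} = insert (Suc (Suc N)) {1..Suc N}" by auto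
  then have "(MAX j\<in>{1..Suc (Suc N)}. int (psum n j) - int (psum m (j - 1)))
      = max (int (psum n (Suc (Suc N))) - int (psum m (Suc N))) (int (overflow m n (Suc N)))"
    using Suc by (simp only: image_insert, subst Max_insert) auto
  also have "\<dots> = int (overflow m n (Suc (Suc N)))"
    using queue_eq[of m n "Suc N"] by simp
  finally show ?case .
qed simp

definition path_weight :: "real \<Rightarrow> real \<Rightarrow> real \<Rightarrow> nat \<Rightarrow> (nat \<Rightarrow> nat) \<times> (nat \<Rightarrow> nat) \<Rightarrow> real" where
  "path_weight a c s N = (\<lambda>(m, n). s ^ psum m N * a ^ psum n N * c ^ overflow m n N)"

text \<open>The powers of \<open>c2\<close> combine to the queue length, so \<open>c2\<close> enters
  only through the terminal function and not through \<open>path_weight\<close>.\<close>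

lemma G_term_eq:
  assumes "0 < c2" "N \<ge> 1"
  shows "G_term a c1 c2 N t (m, n) = path_weight a c1 (a * t\<^sup>2) N (m, n) * c2 ^ queue m n N"
proof -
  let ?u = "overflow m n N" and ?q = "queue m n N" and ?l = "psum m N" and ?k = "psum n N"
  have "int ?l - int ?k = int ?q - int ?u"
    using queue_eq[of m n N] by linarith
  then have "c2 ^ ?u * c2 powi (int ?l - int ?k) = c2 ^ ?q"
    using assms by (simp add: power_int_diff)
  moreover have "(MAX j\<in>{1..N}. int (psum n j) - int (psum m (j - 1))) = int ?u"
    using overflow_eq_Max[of n m "N - 1"] assms by simp
  moreover have "t ^ (?l * 2) = (t\<^sup>2) ^ ?l"
    by (simp add: power_mult[symmetric] mult.commute)
  ultimately show ?thesis
    by (simp add: G_term_def weight_Q_def path_weight_def power_mult_distrib mult_ac)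
qed

lemma cong_below:
  assumes "\<And>i. 1 \<le> i \<Longrightarrow> i \<le> N \<Longrightarrow> m i = m' i" "\<And>i. 1 \<le> i \<Longrightarrow> i \<le> N \<Longrightarrow> n i = n' i"
  shows psum_cong: "psum m N = psum m' N"
    and queue_cong: "queue m n N = queue m' n' N"
    and overflow_cong: "overflow m n N = overflow m' n' N"
proof -
  show "psum m N = psum m' N" using assms by (simp add: psum_def)
  have "queue m n k = queue m' n' k \<and> overflow m n k = overflow m' n' k" if "k \<le> N" for k
    using that by (induction k) (auto simp: assms)
  then show "queue m n N = queue m' n' N" "overflow m n N = overflow m' n' N" by auto
qed

section \<open>Path sums as iterates of the operator\<close>

abbreviation (input) "seq_pairs N \<equiv> increment_seqs N \<times> increment_seqs N"

text \<open>The order \<open>(q, p)\<close>, with the increment of \<open>n\<close> first, matches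
  the nesting of \<open>tail_sum\<close> inside \<open>step\<close>.\<close>

lemma bij_betw_seq_pairs_Suc:
  "bij_betw (\<lambda>((m, n), (q, p)). (m(Suc N := p), n(Suc N := q)))
    (seq_pairs N \<times> UNIV) (seq_pairs (Suc N))"
proof (rule bij_betw_byWitness[where
      f' = "\<lambda>(m, n). ((restrict m {1..N}, restrict n {1..N}), (n (Suc N), m (Suc N)))"])
  show "\<forall>x\<in>seq_pairs N \<times> UNIV.
      (\<lambda>(m, n). ((restrict m {1..N}, restrict n {1..N}), (n (Suc N), m (Suc N))))
        ((\<lambda>((m, n), (q, p)). (m(Suc N := p), n(Suc N := q))) x) = x"
    by (auto simp: increment_seqs_def PiE_def extensional_def restrict_def fun_eq_iff)
  show "\<forall>x\<in>seq_pairs (Suc N).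
      (\<lambda>((m, n), (q, p)). (m(Suc N := p), n(Suc N := q)))
        ((\<lambda>(m, n). ((restrict m {1..N}, restrict n {1..N}), (n (Suc N), m (Suc N)))) x) = x"
    by (auto simp: increment_seqs_def PiE_def extensional_def restrict_def fun_eq_iff)
qed (auto simp: increment_seqs_def PiE_def extensional_def)

text \<open>Tonelli for counting measures, reduced to the whole type by the indicator of
  \<open>A\<close>.\<close>

lemma nn_integral_count_space_times:
  "(\<integral>\<^sup>+z. f z \<partial>count_space (A \<times> UNIV))
    = (\<integral>\<^sup>+x. \<integral>\<^sup>+y. f (x, y) \<partial>count_space UNIV \<partial>count_space A)"
proof -
  have "(\<integral>\<^sup>+z. f z \<partial>count_space (A \<times> UNIV))
      = (\<integral>\<^sup>+z. f z * indicator (A \<times> UNIV) z \<partial>count_space UNIV)"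
    by (simp add: nn_integral_count_space_indicator)
  also have "\<dots> = (\<integral>\<^sup>+x. \<integral>\<^sup>+y. f (x, y) * indicator A x \<partial>count_space UNIV \<partial>count_space UNIV)"
    by (subst nn_integral_fst_count_space[symmetric]) (simp add: indicator_def)
  also have "\<dots> = (\<integral>\<^sup>+x. (\<integral>\<^sup>+y. f (x, y) \<partial>count_space UNIV) * indicator A x \<partial>count_space UNIV)"
    by (simp add: nn_integral_multc)
  finally show ?thesis
    by (simp add: nn_integral_count_space_indicator)
qed

text \<open>Summing out the last pair of increments replaces \<open>f\<close> by
  \<open>step a c s f\<close>, hence the induction with \<open>f\<close> arbitrary.\<close>

lemma path_expansion:
  assumes "0 \<le> a" "0 \<le> c" "0 \<le> s"
  shows "(\<integral>\<^sup>+x. ennreal (path_weight a c s N x) * f (case_prod queue x N) \<partial>count_space (seq_pairs N))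
    = (step a c s ^^ N) f 0"
proof (induction N arbitrary: f)
  case 0
  \<comment> \<open>The empty path is a single pair of functions, with weight 1 and queue length
    0.\<close>
  have "seq_pairs 0 = {(\<lambda>_. undefined, \<lambda>_. undefined)}"
    by (auto simp: increment_seqs_def)
  then show ?case
    by (simp add: nn_integral_count_space_finite path_weight_def)
next
  case (Suc N)
  let ?h = "\<lambda>((m, n), (q, p)). (m(Suc N := p), n(Suc N := q))"
  let ?F = "\<lambda>x. ennreal (path_weight a c s (Suc N) x) * f (case_prod queue x (Suc N))"
  have F: "?F (?h (x, (q, p))) = ennreal (path_weight a c s N x)
      * (ennreal (a ^ q * c ^ (q - case_prod queue x N)) * (ennreal (s ^ p) * f (case_prod queue x N - q + p)))"
    for x q p
  proof -
    obtain m n where x: "x = (m, n)" by fastforce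
    have "psum (m(Suc N := p)) N = psum m N" "psum (n(Suc N := q)) N = psum n N"
      by (rule psum_cong; simp)+
    moreover have "queue (m(Suc N := p)) (n(Suc N := q)) N = queue m n N"
      by (rule queue_cong) auto
    moreover have "overflow (m(Suc N := p)) (n(Suc N := q)) N = overflow m n N"
      by (rule overflow_cong) auto
    ultimately show ?thesis
      using assms by (simp add: x path_weight_def power_add ennreal_mult mult_ac)
  qed
  have "(\<integral>\<^sup>+x. ?F x \<partial>count_space (seq_pairs (Suc N)))
      = (\<integral>\<^sup>+z. ?F (?h z) \<partial>count_space (seq_pairs N \<times> UNIV))"
    using nn_integral_bij_count_space[OF bij_betw_seq_pairs_Suc[of N], of ?F] by simp
  also have "\<dots> = (\<integral>\<^sup>+x. \<integral>\<^sup>+q. \<integral>\<^sup>+p. ?F (?h (x, (q, p)))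
      \<partial>count_space UNIV \<partial>count_space UNIV \<partial>count_space (seq_pairs N))"
    by (subst nn_integral_count_space_times, subst nn_integral_fst_count_space[symmetric]) simp
  also have "\<dots> = (\<integral>\<^sup>+x. ennreal (path_weight a c s N x) * step a c s f (case_prod queue x N)
      \<partial>count_space (seq_pairs N))"
    unfolding F by (simp add: nn_integral_cmult nn_integral_count_space_nat step_def tail_sum_def)
  also have "\<dots> = (step a c s ^^ N) (step a c s f) 0"
    by (rule Suc)
  finally show ?case by (simp add: funpow_swap1)
qed

section \<open>Summability and value of \<open>G\<close>\<close>

lemma summable_on_and_infsum_via_nn_integral:
  fixes f :: "'a \<Rightarrow> real"
  assumes nn: "\<And>x. x \<in> A \<Longrightarrow> 0 \<le> f x" and I: "(\<integral>\<^sup>+x. ennreal (f x) \<partial>count_space A) = I" "I < top"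
  shows "f summable_on A" "infsum f A = enn2real I"
proof -
  have "integrable (count_space A) f"
    using nn I by (intro integrableI_nonneg) (auto simp: AE_count_space)
  then have abs: "Infinite_Set_Sum.abs_summable_on f A"
    by (simp add: abs_summable_on_def)
  then show "f summable_on A"
    using abs_summable_equivalent abs_summable_summable by blast
  have "infsum f A = infsetsum f A"
    using abs by (simp add: infsetsum_infsum)
  also have "\<dots> = enn2real I"
    using infsetsum_conv_nn_integral[of A f] nn I by simp
  finally show "infsum f A = enn2real I" .
qed

lemma G_eq_step:
  assumes "0 < a" "0 < c1" "a * c1 < 1" "0 < c2" "0 < t" "a * a * t\<^sup>2 < 1" "a * c2 * t\<^sup>2 < 1" "N \<ge> 1"
  shows "G_term a c1 c2 N t summable_on seq_pairs N"
    and "G a c1 c2 N t = enn2real ((step a c1 (a * t\<^sup>2) ^^ N) (\<lambda>k. ennreal (c2 ^ k)) 0)"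
proof -
  let ?s = "a * t\<^sup>2"
  let ?T = "step a c1 ?s ^^ N"
  have s: "0 < ?s" using assms by simp
  \<comment> \<open>\<open>funpow_step_power_le\<close> needs a base above \<open>a\<close>, which
    \<open>c2\<close> need not be; a larger \<open>x\<close>, still below \<open>1 / ?s\<close>,
    dominates it.\<close>
  have "max a c2 < 1 / ?s"
    using s assms by (auto simp: field_simps)
  then obtain x where x: "max a c2 < x" "x < 1 / ?s"
    using dense by blast
  then have "a < x" "?s * x < 1" using s by (auto simp: field_simps)
  then obtain L where "0 \<le> L" and L: "\<And>N k. (step a c1 ?s ^^ N) (\<lambda>k. ennreal (x ^ k)) k \<le> ennreal (L ^ N * x ^ k)"
    using funpow_step_power_le[of a c1 ?s x] assms s by auto
  from L[of N 0] have fin: "?T (\<lambda>k. ennreal (x ^ k)) 0 < top"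
    by (rule order.strict_trans1) simp
  have "?T (\<lambda>k. ennreal (c2 ^ k)) k \<le> ?T (\<lambda>k. ennreal (x ^ k)) k" for k
  proof (induction N arbitrary: k)
    case 0
    then show ?case using x assms by (auto intro!: ennreal_leI power_mono)
  qed (auto intro: step_mono)
  from order.strict_trans1[OF this fin] have fin': "?T (\<lambda>k. ennreal (c2 ^ k)) 0 < top" .
  have eq: "G_term a c1 c2 N t x = path_weight a c1 ?s N x * c2 ^ case_prod queue x N" for x
    using assms by (cases x) (simp add: G_term_eq)
  have nn: "0 \<le> path_weight a c1 ?s N x" for x
    using assms s by (cases x) (simp add: path_weight_def)
  have nn': "0 \<le> G_term a c1 c2 N t x" for x
    using nn assms by (simp add: eq)
  have "(\<integral>\<^sup>+x. ennreal (G_term a c1 c2 N t x) \<partial>count_space (seq_pairs N)) = ?T (\<lambda>k. ennreal (c2 ^ k)) 0"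
    using path_expansion[of a c1 ?s N "\<lambda>k. ennreal (c2 ^ k)"] assms s nn
    by (simp add: eq ennreal_mult)
  from summable_on_and_infsum_via_nn_integral[OF nn' this fin']
  show "G_term a c1 c2 N t summable_on seq_pairs N"
    and "G a c1 c2 N t = enn2real (?T (\<lambda>k. ennreal (c2 ^ k)) 0)"
    by (auto simp: G_def)
qed

section \<open>Specialisation to the root \<open>B\<close>\<close>

theorem proposition1p2:
  fixes a t c1 c2 :: real
  assumes "a \<in> {0<..<1}" and "a * t \<in> {0<..<1}"
    and "a * c1 \<in> {0<..<1}" and "a * c2 * t\<^sup>2 \<in> {0<..<1}"
  shows "(\<forall>N\<ge>1. G_term a c1 c2 N t summable_on (increment_seqs N \<times> increment_seqs N)) \<and>
    (\<forall>z. 0 \<le> z \<and> z < (1 - a * t)\<^sup>2 \<longrightarrow>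
      (let B = smaller_root z (a * t) in
        B < 1 \<and>
        (B * c1 < t \<and> B * c2 * t < 1 \<longrightarrow>
          (\<lambda>N. z ^ N * G a c1 c2 (Suc N) t) sums
            (B / (a * (t - c1 * B) * (1 - c2 * t * B))))))"
proof (intro conjI allI impI)
  have a: "0 < a" "a < 1" using assms by auto
  have t: "0 < t" "a * t < 1" and c1: "0 < c1" "a * c1 < 1"
    using assms a by (auto simp: zero_less_mult_iff)
  have c2: "0 < c2" "a * c2 * t\<^sup>2 < 1"
    using assms a t by (auto simp: zero_less_mult_iff)
  have "(a * t)\<^sup>2 < 1" using a t by (simp add: power_less_one_iff)
  then have at: "a * a * t\<^sup>2 < 1" by (simp add: power_mult_distrib power2_eq_square mult_ac)
  note G = G_eq_step[OF a(1) c1 c2(1) t(1) at c2(2)]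
  show "G_term a c1 c2 N t summable_on (increment_seqs N \<times> increment_seqs N)" if "N \<ge> 1" for N
    by (rule G(1)[OF that])
  fix z assume z: "0 \<le> z \<and> z < (1 - a * t)\<^sup>2"
  define B where "B = smaller_root z (a * t)"
  have B: "is_root_B z (a * t) B" "0 < B" "B < 1"
    using smaller_root_wellposed[of "a * t" z] a t z by (auto simp: B_def)
  \<comment> \<open>The equation for \<open>B\<close>, multiplied by \<open>a * t * B\<close> and
    factored; scaling by \<open>t\<close> turns it into the condition of
    \<open>step_sums\<close>.\<close>
  then have root: "(1 - a * t * B) * (B - a * t) = z * B"
    using a t by (auto simp: is_root_B_def field_simps)
  have atB: "a * t * B < 1"
    using mult_strict_mono[of "a * t" 1 B 1] B t a by simp
  \<comment> \<open>It is \<open>z \<ge> 0\<close> that forces \<open>a * t \<le> B\<close>, which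
    becomes the condition \<open>s \<le> r\<close>.\<close>
  have "0 \<le> (1 - a * t * B) * (B - a * t)" using root z B by simp
  then have atB': "a * t \<le> B" using atB by (simp add: zero_le_mult_iff)
  have "(\<lambda>N. z ^ N * G a c1 c2 (Suc N) t) sums (B / (a * (t - c1 * B) * (1 - c2 * t * B)))"
    if h: "B * c1 < t" "B * c2 * t < 1"
  proof -
    \<comment> \<open>Here \<open>r = t * B\<close>, \<open>s = a * t\<^sup>2\<close> and
      \<open>x = c2\<close>; the two parts of \<open>h\<close> become \<open>a * c * r < s\<close>
      and \<open>r * x < 1\<close>.\<close>
    have "(\<lambda>N. z ^ N * enn2real ((step a c1 (a * t\<^sup>2) ^^ Suc N) (\<lambda>k. ennreal (c2 ^ k)) 0))
        sums (t * B / ((a * t\<^sup>2 - a * c1 * (t * B)) * (1 - t * B * c2)))"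
    proof (rule step_sums)
      show "a * t\<^sup>2 \<le> t * B"
        using atB' t by (simp add: power2_eq_square)
      show "a * (t * B) < 1" using atB by (simp add: mult_ac)
      show "a * c1 * (t * B) < a * t\<^sup>2"
        using h a t by (simp add: power2_eq_square mult_ac)
      have "B\<^sup>2 < 1" using B by (simp add: power_less_one_iff)
      then show "a * (t * B)\<^sup>2 < a * t\<^sup>2"
        using a t by (simp add: power_mult_distrib)
      have "(1 - a * (t * B)) * (t * B - a * t\<^sup>2) = t * ((1 - a * t * B) * (B - a * t))"
        by (simp add: algebra_simps power2_eq_square)
      then show "(1 - a * (t * B)) * (t * B - a * t\<^sup>2) = z * (t * B)"
        unfolding root by simp
      show "t * B * c2 < 1" using h by (simp add: mult_ac)
    qed (use a t c1 c2 z in auto)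
    also have "t * B / ((a * t\<^sup>2 - a * c1 * (t * B)) * (1 - t * B * c2))
        = (t * B) / (t * (a * (t - c1 * B) * (1 - c2 * t * B)))"
      by (simp add: algebra_simps power2_eq_square)
    also have "\<dots> = B / (a * (t - c1 * B) * (1 - c2 * t * B))"
      using t by simp
    \<comment> \<open>\<open>z ^ N\<close> goes with \<open>Suc N\<close>, the index shift of a sum
      starting at 1, so \<open>G(2)\<close> applies to every term.\<close>
    finally show ?thesis by (simp add: G(2) del: funpow.simps)
  qed
  then show "let B = smaller_root z (a * t) in B < 1 \<and>
        (B * c1 < t \<and> B * c2 * t < 1 \<longrightarrow>
          (\<lambda>N. z ^ N * G a c1 c2 (Suc N) t) sums (B / (a * (t - c1 * B) * (1 - c2 * t * B))))"
    using B(3) by (simp add: B_def[symmetric] Let_def)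
qed

end
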